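(* Let $F_2$ be the free group with basis $\{a,b\}$. Then $$\mathfrak{X}(F_2) = \langle a,b,\overline{a},\overline{b}\mid [w,\overline{w}],\ w\in\Upsilon_2\rangle,$$ where $\Upsilon_2=\{a,\ b,\ ab,\ ab^{-1},\ a^{-1}b,\ ba,\ aba,\ a^{-1}ba,\ aba^{-1},\ bab,\ b^{-1}ab,\ bab^{-1}\}$.
   Context: For a group $G$, let $\overline{G}$ be a second copy of $G$ with a fixed isomorphism $g\mapsto\overline{g}$ from $G$ to $\overline{G}$. The group $\mathfrak{X}(G)$ is the quotient of the free product $G\ast\overline{G}$ by the normal closure of the set $\{[g,\overline{g}] : g\in G\}$. For a word $w$ in $a^{\pm1},b^{\pm1}$, $\overline{w}$ denotes the word obtained by replacing $a^{\pm1},b^{\pm1}$ with $\overline{a}^{\pm1},\overline{b}^{\pm1}$. In the presentation, the generators $a,b,\overline{a},\overline{b}$ map to the elements of $\mathfrak{X}(F_2)$ with the same names. *)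

theory Defs
  imports "HOL-Algebra.Coset"
begin

section \<open>Quotients of free monoids\<close>

inductive_set word_cong :: "'c set \<Rightarrow> ('c list \<times> 'c list) set \<Rightarrow> ('c list \<times> 'c list) set"
  for A :: "'c set" and R :: "('c list \<times> 'c list) set"
where
  refl: "w \<in> lists A \<Longrightarrow> (w, w) \<in> word_cong A R"
| step: "\<lbrakk>(u, v) \<in> R; u \<in> lists A; v \<in> lists A; p \<in> lists A; q \<in> lists A\<rbrakk>
          \<Longrightarrow> (p @ u @ q, p @ v @ q) \<in> word_cong A R"
| sym: "(u, v) \<in> word_cong A R \<Longrightarrow> (v, u) \<in> word_cong A R"
| trans: "\<lbrakk>(u, v) \<in> word_cong A R; (v, w) \<in> word_cong A R\<rbrakk> \<Longrightarrow> (u, w) \<in> word_cong A R"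

definition word_monoid :: "'c set \<Rightarrow> ('c list \<times> 'c list) set \<Rightarrow> 'c list set monoid" where
  "word_monoid A R =
    \<lparr>carrier = lists A // word_cong A R,
     mult = (\<lambda>U V. \<Union>u\<in>U. \<Union>v\<in>V. word_cong A R `` {u @ v}),
     one = word_cong A R `` {[]}\<rparr>"

lemma word_cong_lists:
  "(u, v) \<in> word_cong A R \<Longrightarrow> u \<in> lists A \<and> v \<in> lists A"
  by (induction rule: word_cong.induct) auto

lemma word_cong_base:
  "\<lbrakk>(u, v) \<in> R; u \<in> lists A; v \<in> lists A\<rbrakk> \<Longrightarrow> (u, v) \<in> word_cong A R"
  using word_cong.step[of u v R A "[]" "[]"] by simp

lemma equiv_word_cong: "equiv (lists A) (word_cong A R)"
proof (rule equivI)
  show "word_cong A R \<subseteq> lists A \<times> lists A"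
    by (auto dest!: word_cong_lists)
  show "refl_on (lists A) (word_cong A R)"
    by (rule refl_onI) (rule word_cong.refl)
  show "sym (word_cong A R)"
    by (rule symI) (rule word_cong.sym)
  show "trans (word_cong A R)"
    by (rule transI) (rule word_cong.trans)
qed

lemma word_cong_context:
  assumes "(u, v) \<in> word_cong A R" "p \<in> lists A" "q \<in> lists A"
  shows "(p @ u @ q, p @ v @ q) \<in> word_cong A R"
  using assms
proof (induction rule: word_cong.induct)
  case (refl w)
  then show ?case by (intro word_cong.refl) simp
next
  case (step u v p' q')
  then show ?case
    using word_cong.step[of u v R A "p @ p'" "q' @ q"] by simp
next
  case (sym u v)
  then show ?case by (metis word_cong.sym)
next
  case (trans u v w)
  then show ?case by (metis word_cong.trans)
qed

lemma word_cong_append: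
  assumes "(u, u') \<in> word_cong A R" "(v, v') \<in> word_cong A R"
  shows "(u @ v, u' @ v') \<in> word_cong A R"
proof -
  have "(u @ v, u' @ v) \<in> word_cong A R"
    using word_cong_context[OF assms(1), of "[]" v] word_cong_lists[OF assms(2)] by simp
  moreover have "(u' @ v, u' @ v') \<in> word_cong A R"
    using word_cong_context[OF assms(2), of u' "[]"] word_cong_lists[OF assms(1)] by simp
  ultimately show ?thesis by (rule word_cong.trans)
qed

lemma word_monoid_mult:
  assumes "u \<in> lists A" "v \<in> lists A"
  shows "word_cong A R `` {u} \<otimes>\<^bsub>word_monoid A R\<^esub> word_cong A R `` {v} = word_cong A R `` {u @ v}"
proof -
  have eq: "word_cong A R `` {u' @ v'} = word_cong A R `` {u @ v}"
    if "u' \<in> word_cong A R `` {u}" "v' \<in> word_cong A R `` {v}" for u' v'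
    using equiv_class_eq[OF equiv_word_cong word_cong_append] that by fastforce
  have "u \<in> word_cong A R `` {u}" "v \<in> word_cong A R `` {v}"
    using assms by (auto intro: word_cong.refl)
  then show ?thesis
    unfolding word_monoid_def monoid.simps using eq by blast
qed

lemma word_monoid_carrierE:
  assumes "U \<in> carrier (word_monoid A R)"
  obtains u where "u \<in> lists A" "U = word_cong A R `` {u}"
  using assms unfolding word_monoid_def by (auto elim!: quotientE simp del: in_lists_conv_set)

lemma word_monoid_closed:
  "u \<in> lists A \<Longrightarrow> word_cong A R `` {u} \<in> carrier (word_monoid A R)"
  by (auto simp: word_monoid_def intro: quotientI)

lemma word_monoid_one: "\<one>\<^bsub>word_monoid A R\<^esub> = word_cong A R `` {[]}"
  by (simp add: word_monoid_def)

lemma monoid_word_monoid: "monoid (word_monoid A R)"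
proof (rule monoidI)
  show "\<one>\<^bsub>word_monoid A R\<^esub> \<in> carrier (word_monoid A R)"
    by (simp add: word_monoid_one word_monoid_closed)
qed (elim word_monoid_carrierE;
      simp add: word_monoid_one word_monoid_mult word_monoid_closed del: in_lists_conv_set)+

lemma group_word_monoid:
  assumes "\<And>x. x \<in> A \<Longrightarrow> \<exists>y\<in>A. ([y, x], []) \<in> word_cong A R"
  shows "group (word_monoid A R)"
proof -
  interpret monoid "word_monoid A R" by (rule monoid_word_monoid)
  have linv: "\<exists>u'\<in>lists A. (u' @ u, []) \<in> word_cong A R" if "u \<in> lists A" for u
    using that
  proof (induction u rule: rev_induct)
    case Nil
    then show ?case by (auto intro: word_cong.refl)
  next
    case (snoc x u)
    then obtain u' where u': "u' \<in> lists A" "(u' @ u, []) \<in> word_cong A R" by auto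
    from snoc obtain y where y: "y \<in> A" "([y, x], []) \<in> word_cong A R"
      using assms[of x] by auto
    have "([y] @ (u' @ u) @ [x], [y] @ [] @ [x]) \<in> word_cong A R"
      using snoc y u' by (intro word_cong_context) auto
    then have "((y # u') @ (u @ [x]), []) \<in> word_cong A R"
      using word_cong.trans[OF _ y(2)] by simp
    then show ?case using y u' by (intro bexI[of _ "y # u'"]) auto
  qed
  show ?thesis
  proof (rule group_l_invI)
    fix U assume "U \<in> carrier (word_monoid A R)"
    then obtain u where u: "u \<in> lists A" "U = word_cong A R `` {u}"
      by (rule word_monoid_carrierE)
    with linv obtain u' where u': "u' \<in> lists A" "(u' @ u, []) \<in> word_cong A R" by blast
    then have "word_cong A R `` {u' @ u} = word_cong A R `` {[]}"
      by (intro equiv_class_eq[OF equiv_word_cong])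
    then show "\<exists>V\<in>carrier (word_monoid A R). V \<otimes>\<^bsub>word_monoid A R\<^esub> U = \<one>\<^bsub>word_monoid A R\<^esub>"
      using u u'(1)
      by (intro bexI[of _ "word_cong A R `` {u'}"])
        (auto simp: word_monoid_mult word_monoid_one word_monoid_closed simp del: in_lists_conv_set)
  qed
qed


section \<open>Free groups\<close>

text \<open>\<open>Pos x\<close> stands for the letter \<open>x\<close>, and \<open>Neg x\<close> for its formal inverse.\<close>

datatype 'a letter = Pos 'a | Neg 'a

definition letters :: "'a set \<Rightarrow> 'a letter set" where
  "letters X = Pos ` X \<union> Neg ` X"

definition cancellations :: "'a set \<Rightarrow> ('a letter list \<times> 'a letter list) set" where
  "cancellations X =
    (\<Union>x\<in>X. {([Pos x, Neg x], []), ([Neg x, Pos x], [])})"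

definition free_group :: "'a set \<Rightarrow> 'a letter list set monoid" where
  "free_group X = word_monoid (letters X) (cancellations X)"

definition word_elt :: "'a set \<Rightarrow> 'a letter list \<Rightarrow> 'a letter list set" where
  "word_elt X w = word_cong (letters X) (cancellations X) `` {w}"

lemma group_free_group: "group (free_group X)"
  unfolding free_group_def
proof (rule group_word_monoid)
  fix l assume "l \<in> letters X"
  then consider x where "x \<in> X" "l = Pos x" | x where "x \<in> X" "l = Neg x"
    by (auto simp: letters_def)
  then show "\<exists>m\<in>letters X. ([m, l], []) \<in> word_cong (letters X) (cancellations X)"
  proof cases
    case 1
    then show ?thesis
      using word_cong.step[of "[Neg x, Pos x]" "[]" "cancellations X" "letters X" "[]" "[]"]
      by (intro bexI[of _ "Neg x"]) (auto simp: letters_def cancellations_def)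
  next
    case 2
    then show ?thesis
      using word_cong.step[of "[Pos x, Neg x]" "[]" "cancellations X" "letters X" "[]" "[]"]
      by (intro bexI[of _ "Pos x"]) (auto simp: letters_def cancellations_def)
  qed
qed


section \<open>Free products\<close>

definition product_moves ::
  "('g, 'x) monoid_scheme \<Rightarrow> ('h, 'y) monoid_scheme \<Rightarrow> (('g + 'h) list \<times> ('g + 'h) list) set" where
  "product_moves G H =
     {([Inl x, Inl y], [Inl (x \<otimes>\<^bsub>G\<^esub> y)]) | x y. x \<in> carrier G \<and> y \<in> carrier G}
   \<union> {([Inr x, Inr y], [Inr (x \<otimes>\<^bsub>H\<^esub> y)]) | x y. x \<in> carrier H \<and> y \<in> carrier H}
   \<union> {([Inl \<one>\<^bsub>G\<^esub>], []), ([Inr \<one>\<^bsub>H\<^esub>], [])}"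

definition free_product ::
  "('g, 'x) monoid_scheme \<Rightarrow> ('h, 'y) monoid_scheme \<Rightarrow> ('g + 'h) list set monoid" where
  "free_product G H = word_monoid (carrier G <+> carrier H) (product_moves G H)"

definition product_inl ::
  "('g, 'x) monoid_scheme \<Rightarrow> ('h, 'y) monoid_scheme \<Rightarrow> 'g \<Rightarrow> ('g + 'h) list set" where
  "product_inl G H g = word_cong (carrier G <+> carrier H) (product_moves G H) `` {[Inl g]}"

definition product_inr ::
  "('g, 'x) monoid_scheme \<Rightarrow> ('h, 'y) monoid_scheme \<Rightarrow> 'h \<Rightarrow> ('g + 'h) list set" where
  "product_inr G H h = word_cong (carrier G <+> carrier H) (product_moves G H) `` {[Inr h]}"

lemma group_free_product:
  assumes "group G" "group H"
  shows "group (free_product G H)"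
  unfolding free_product_def
proof (rule group_word_monoid)
  interpret G: group G by fact
  interpret H: group H by fact
  let ?A = "carrier G <+> carrier H" and ?R = "product_moves G H"
  fix l assume "l \<in> ?A"
  then consider x where "x \<in> carrier G" "l = Inl x" | x where "x \<in> carrier H" "l = Inr x"
    by auto
  then show "\<exists>m\<in>?A. ([m, l], []) \<in> word_cong ?A ?R"
  proof cases
    case 1
    then have "([Inl (inv\<^bsub>G\<^esub> x), Inl x], [Inl \<one>\<^bsub>G\<^esub>]) \<in> ?R"
      unfolding product_moves_def by (force simp: G.l_inv)
    moreover have "([Inl \<one>\<^bsub>G\<^esub>], []) \<in> ?R"
      by (simp add: product_moves_def)
    ultimately have "([Inl (inv\<^bsub>G\<^esub> x), Inl x], []) \<in> word_cong ?A ?R"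
      using 1 by (intro word_cong.trans[OF word_cong_base word_cong_base]) auto
    with 1 show ?thesis by (intro bexI[of _ "Inl (inv\<^bsub>G\<^esub> x)"]) auto
  next
    case 2
    then have "([Inr (inv\<^bsub>H\<^esub> x), Inr x], [Inr \<one>\<^bsub>H\<^esub>]) \<in> ?R"
      unfolding product_moves_def by (force simp: H.l_inv)
    moreover have "([Inr \<one>\<^bsub>H\<^esub>], []) \<in> ?R"
      by (simp add: product_moves_def)
    ultimately have "([Inr (inv\<^bsub>H\<^esub> x), Inr x], []) \<in> word_cong ?A ?R"
      using 2 by (intro word_cong.trans[OF word_cong_base word_cong_base]) auto
    with 2 show ?thesis by (intro bexI[of _ "Inr (inv\<^bsub>H\<^esub> x)"]) auto
  qed
qed


section \<open>Presentations and weak commutativity\<close>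

definition commutator :: "('g, 'x) monoid_scheme \<Rightarrow> 'g \<Rightarrow> 'g \<Rightarrow> 'g" where
  "commutator G x y = x \<otimes>\<^bsub>G\<^esub> y \<otimes>\<^bsub>G\<^esub> inv\<^bsub>G\<^esub> x \<otimes>\<^bsub>G\<^esub> inv\<^bsub>G\<^esub> y"

definition normal_closure :: "('g, 'x) monoid_scheme \<Rightarrow> 'g set \<Rightarrow> 'g set" where
  "normal_closure G S = \<Inter>{N. N \<lhd> G \<and> S \<subseteq> N}"

text \<open>The relators are given as elements of the free group on the generators.\<close>

definition presentation ::
  "'a set \<Rightarrow> 'a letter list set set \<Rightarrow> 'a letter list set set monoid" where
  "presentation X R = free_group X Mod normal_closure (free_group X) R"

definition presentation_gen ::
  "'a set \<Rightarrow> 'a letter list set set \<Rightarrow> 'a \<Rightarrow> 'a letter list set set" where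
  "presentation_gen X R x = normal_closure (free_group X) R #>\<^bsub>free_group X\<^esub> word_elt X [Pos x]"

text \<open>The second copy of \<open>G\<close> is the right-hand factor of \<open>free_product G G\<close>.\<close>

definition chi_kernel :: "('g, 'x) monoid_scheme \<Rightarrow> ('g + 'g) list set set" where
  "chi_kernel G = normal_closure (free_product G G)
     {commutator (free_product G G) (product_inl G G g) (product_inr G G g) | g. g \<in> carrier G}"

definition chi :: "('g, 'x) monoid_scheme \<Rightarrow> ('g + 'g) list set set monoid" where
  "chi G = free_product G G Mod chi_kernel G"

definition chi_elt :: "('g, 'x) monoid_scheme \<Rightarrow> 'g \<Rightarrow> ('g + 'g) list set set" where
  "chi_elt G g = chi_kernel G #>\<^bsub>free_product G G\<^esub> product_inl G G g"

definition chi_bar :: "('g, 'x) monoid_scheme \<Rightarrow> 'g \<Rightarrow> ('g + 'g) list set set" where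
  "chi_bar G g = chi_kernel G #>\<^bsub>free_product G G\<^esub> product_inr G G g"


section \<open>The finite set of relators\<close>

definition Upsilon2 :: "'a \<Rightarrow> 'a \<Rightarrow> 'a letter list set" where
  "Upsilon2 a b =
    {[Pos a], [Pos b], [Pos a, Pos b], [Pos a, Neg b], [Neg a, Pos b], [Pos b, Pos a],
     [Pos a, Pos b, Pos a], [Neg a, Pos b, Pos a], [Pos a, Pos b, Neg a],
     [Pos b, Pos a, Pos b], [Neg b, Pos a, Pos b], [Pos b, Pos a, Neg b]}"

text \<open>
  The four generators \<open>a\<close>, \<open>b\<close> and their barred copies are \<open>Inl a\<close>, \<open>Inl b\<close>, \<open>Inr a\<close>, \<open>Inr b\<close>.
\<close>

definition gens4 :: "'a \<Rightarrow> 'a \<Rightarrow> ('a + 'a) set" where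
  "gens4 a b = {Inl a, Inl b, Inr a, Inr b}"

definition plain_word :: "'a letter list \<Rightarrow> ('a + 'a) letter list" where
  "plain_word w = map (map_letter Inl) w"

definition bar_word :: "'a letter list \<Rightarrow> ('a + 'a) letter list" where
  "bar_word w = map (map_letter Inr) w"

definition relators :: "'a \<Rightarrow> 'a \<Rightarrow> ('a + 'a) letter list set set" where
  "relators a b =
    {commutator (free_group (gens4 a b))
       (word_elt (gens4 a b) (plain_word w)) (word_elt (gens4 a b) (bar_word w)) |
     w. w \<in> Upsilon2 a b}"

end

(*
Write g' for the copy of g and call g good if [g, g'] = 1. For good g and h, the product g^-1 h is
good if and only if [g, h'] = [g', h]. Hence, if a, b, ab, ab^-1, a^-1 b and ba are good, then
d = [a, b'] = [a', b], and conjugating d by a gives the same result as conjugating it by a', and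
likewise for b. It follows that these six conditions are inherited by the pairs obtained from (a, b)
by Nielsen moves, in particular by the conjugates of (a, b) by a, b and their inverses, and that
conjugating the pair by a generator z replaces d by its conjugate by z, or equally by z'.
Induction on the word w shows that the conjugates of d by w and by w' agree for all w in F_2.
The elements of the quotient with this property form a subgroup normalised by F_2, so the commutator
identities extend [g, h'] = [g', h] from the generators to all g and h, and then every element of
F_2 is good.
*)
theory Submission
  imports Defs "HOL-Algebra.Generated_Groups"
begin

section \<open>Commutators and conjugation\<close>

definition conj_by :: "('g, 'x) monoid_scheme \<Rightarrow> 'g \<Rightarrow> 'g \<Rightarrow> 'g" where
  "conj_by G g x = g \<otimes>\<^bsub>G\<^esub> x \<otimes>\<^bsub>G\<^esub> inv\<^bsub>G\<^esub> g"

context group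
begin

lemma inv_cancel_left [simp]:
  assumes "x \<in> carrier G" "y \<in> carrier G"
  shows "inv x \<otimes> (x \<otimes> y) = y" "x \<otimes> (inv x \<otimes> y) = y"
  using assms by (simp_all flip: m_assoc)

lemma conj_by_closed [simp]:
  "\<lbrakk>g \<in> carrier G; x \<in> carrier G\<rbrakk> \<Longrightarrow> conj_by G g x \<in> carrier G"
  by (simp add: conj_by_def)

lemma conj_by_one [simp]: "g \<in> carrier G \<Longrightarrow> conj_by G g \<one> = \<one>"
  by (simp add: conj_by_def)

lemma conj_by_one_left [simp]: "x \<in> carrier G \<Longrightarrow> conj_by G \<one> x = x"
  by (simp add: conj_by_def)

lemma conj_by_mult:
  assumes "g \<in> carrier G" "x \<in> carrier G" "y \<in> carrier G"
  shows "conj_by G g (x \<otimes> y) = conj_by G g x \<otimes> conj_by G g y"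
  using assms by (simp add: conj_by_def m_assoc)

lemma conj_by_inv:
  assumes "g \<in> carrier G" "x \<in> carrier G"
  shows "conj_by G g (inv x) = inv (conj_by G g x)"
  using assms by (simp add: conj_by_def m_assoc inv_mult_group)

lemma conj_by_conj_by:
  assumes "g \<in> carrier G" "h \<in> carrier G" "x \<in> carrier G"
  shows "conj_by G g (conj_by G h x) = conj_by G (g \<otimes> h) x"
  using assms by (simp add: conj_by_def m_assoc inv_mult_group)

lemma conj_by_eq_self:
  assumes "g \<in> carrier G" "x \<in> carrier G" "g \<otimes> x = x \<otimes> g"
  shows "conj_by G g x = x"
  using assms by (simp add: conj_by_def m_assoc)

lemma commutator_closed [simp]:
  "\<lbrakk>x \<in> carrier G; y \<in> carrier G\<rbrakk> \<Longrightarrow> commutator G x y \<in> carrier G"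
  by (simp add: commutator_def)

lemma commutator_eq_one_iff:
  assumes "x \<in> carrier G" "y \<in> carrier G"
  shows "commutator G x y = \<one> \<longleftrightarrow> x \<otimes> y = y \<otimes> x"
proof -
  have "commutator G x y = (x \<otimes> y) \<otimes> inv (y \<otimes> x)"
    using assms by (simp add: commutator_def inv_mult_group m_assoc)
  then show ?thesis
    using assms by (metis inv_solve_right' l_one m_closed one_closed)
qed

lemma inv_commutator:
  assumes "x \<in> carrier G" "y \<in> carrier G"
  shows "inv (commutator G x y) = commutator G y x"
  using assms by (simp add: commutator_def inv_mult_group m_assoc)

lemma commutator_mult_left:
  assumes "x \<in> carrier G" "y \<in> carrier G" "z \<in> carrier G"
  shows "commutator G (x \<otimes> y) z = conj_by G x (commutator G y z) \<otimes> commutator G x z"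
  using assms by (simp add: commutator_def conj_by_def inv_mult_group m_assoc)

lemma commutator_mult_right:
  assumes "x \<in> carrier G" "y \<in> carrier G" "z \<in> carrier G"
  shows "commutator G x (y \<otimes> z) = commutator G x y \<otimes> conj_by G y (commutator G x z)"
  using assms by (simp add: commutator_def conj_by_def inv_mult_group m_assoc)

lemma commutator_inv_left:
  assumes "x \<in> carrier G" "y \<in> carrier G"
  shows "commutator G (inv x) y = inv (conj_by G (inv x) (commutator G x y))"
  using assms by (simp add: commutator_def conj_by_def inv_mult_group m_assoc)

lemma conj_by_commutator:
  assumes "g \<in> carrier G" "x \<in> carrier G" "y \<in> carrier G"
  shows "conj_by G g (commutator G x y) = commutator G (conj_by G g x) (conj_by G g y)"
  using assms by (simp add: commutator_def conj_by_def inv_mult_group m_assoc)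

text \<open>Multiply the first equation on the left by \<open>x' x = x x'\<close> and on the right
  by \<open>y'^-1 y^-1 = y^-1 y'^-1\<close>, choosing the order of the factors separately on each
  side. All cancels but \<open>[x', y]\<close> on the left side and \<open>[x, y']\<close> on the
  right side.\<close>

lemma commute_mult_iff:
  assumes c: "x \<in> carrier G" "x' \<in> carrier G" "y \<in> carrier G" "y' \<in> carrier G"
    and x: "x \<otimes> x' = x' \<otimes> x" and y: "y \<otimes> y' = y' \<otimes> y"
  shows "(inv x \<otimes> y) \<otimes> (inv x' \<otimes> y') = (inv x' \<otimes> y') \<otimes> (inv x \<otimes> y)
    \<longleftrightarrow> commutator G x y' = commutator G x' y"
proof -
  have "(inv x \<otimes> y) \<otimes> (inv x' \<otimes> y') = (inv x' \<otimes> y') \<otimes> (inv x \<otimes> y)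
    \<longleftrightarrow> (x' \<otimes> x) \<otimes> ((inv x \<otimes> y) \<otimes> (inv x' \<otimes> y')) \<otimes> (inv y' \<otimes> inv y)
        = (x \<otimes> x') \<otimes> ((inv x' \<otimes> y') \<otimes> (inv x \<otimes> y)) \<otimes> (inv y \<otimes> inv y')"
  proof -
    have "inv y' \<otimes> inv y = inv y \<otimes> inv y'"
      using c y by (simp flip: inv_mult_group)
    then show ?thesis using c x by simp
  qed
  also have "\<dots> \<longleftrightarrow> commutator G x' y = commutator G x y'"
    using c by (simp add: commutator_def m_assoc)
  finally show ?thesis by auto
qed

lemma commute_inv_right:
  assumes "x \<in> carrier G" "y \<in> carrier G" "x \<otimes> y = y \<otimes> x"
  shows "x \<otimes> inv y = inv y \<otimes> x"
  using assms by (metis inv_closed inv_solve_left inv_solve_right m_assoc m_closed)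

text \<open>The rule \<open>generate.induct\<close> splits a product into two arbitrary members of
  the subgroup, while the conjugation argument for pairs needs words that grow by one letter on the
  right.\<close>

lemma generate_right_induct [consumes 2, case_names one mult mult_inv]:
  assumes "g \<in> generate G H" "H \<subseteq> carrier G"
    and "P \<one>"
    and "\<And>w h. \<lbrakk>w \<in> carrier G; h \<in> H; P w\<rbrakk> \<Longrightarrow> P (w \<otimes> h)"
    and "\<And>w h. \<lbrakk>w \<in> carrier G; h \<in> H; P w\<rbrakk> \<Longrightarrow> P (w \<otimes> inv h)"
  shows "P g"
proof -
  \<comment> \<open>Quantifying over the left factor \<open>w\<close> makes the claim survive
    products: appending \<open>g h\<close> to \<open>w\<close> means appending \<open>g\<close> and
    then \<open>h\<close>.\<close>
  have "\<forall>w\<in>carrier G. P w \<longrightarrow> P (w \<otimes> g)" if "g \<in> generate G H" for g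
    using that
  proof (induction rule: generate.induct)
    case (eng g h)
    then show ?case
      using generate_in_carrier[OF assms(2)] by (metis m_assoc m_closed)
  qed (use assms in auto)
  then show ?thesis
    using assms(1,3) generate_in_carrier[OF assms(2,1)] by (metis l_one one_closed)
qed

end

section \<open>Two homomorphic images of a group\<close>

text \<open>Here \<open>i\<close> stands for the plain copy and \<open>j\<close> for the barred one;
  comments write \<open>g\<close> for \<open>i g\<close> and \<open>g'\<close> for
  \<open>j g\<close> in \<open>K\<close>. That \<open>i g\<close> and \<open>j g\<close> commute is
  not assumed, so that the locale applies to the presented group, where this is known at first only
  for the words in \<open>Upsilon2\<close>.\<close>

locale two_copies = F: group F + K: group K
  for F :: "('f, 'x) monoid_scheme" (structure) and K :: "('k, 'y) monoid_scheme" +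
  fixes i j :: "'f \<Rightarrow> 'k"
  assumes hom_i: "i \<in> hom F K" and hom_j: "j \<in> hom F K"
begin

sublocale i: group_hom F K i
  by unfold_locales (rule hom_i)

sublocale j: group_hom F K j
  by unfold_locales (rule hom_j)

definition selfcomm :: "'f \<Rightarrow> bool" where
  "selfcomm g \<longleftrightarrow> i g \<otimes>\<^bsub>K\<^esub> j g = j g \<otimes>\<^bsub>K\<^esub> i g"

definition mixed :: "'f \<Rightarrow> 'f \<Rightarrow> 'k" where
  "mixed g h = commutator K (i g) (j h)"

definition symm :: "'f \<Rightarrow> 'f \<Rightarrow> bool" where
  "symm g h \<longleftrightarrow> commutator K (i g) (j h) = commutator K (j g) (i h)"

definition conj_agree :: "'f \<Rightarrow> 'k \<Rightarrow> bool" where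
  "conj_agree g c \<longleftrightarrow> conj_by K (i g) c = conj_by K (j g) c"

lemma mixed_closed [simp]:
  "\<lbrakk>g \<in> carrier F; h \<in> carrier F\<rbrakk> \<Longrightarrow> mixed g h \<in> carrier K"
  by (simp add: mixed_def)

lemma selfcomm_inv:
  assumes "g \<in> carrier F" "selfcomm g"
  shows "selfcomm (inv g)"
  using assms by (simp add: selfcomm_def flip: K.inv_mult_group)

lemma selfcomm_inv_mult_iff:
  assumes "g \<in> carrier F" "h \<in> carrier F" "selfcomm g" "selfcomm h"
  shows "selfcomm (inv g \<otimes> h) \<longleftrightarrow> symm g h"
  using K.commute_mult_iff[of "i g" "j g" "i h" "j h"] assms
  by (simp add: selfcomm_def symm_def)

text \<open>Inverting both sides of \<open>[g, h'] = [g', h]\<close> gives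
  \<open>[h', g] = [h, g']\<close>.\<close>

lemma symm_swap:
  assumes "g \<in> carrier F" "h \<in> carrier F" "symm g h"
  shows "symm h g"
  using assms unfolding symm_def
  by (metis K.inv_commutator i.hom_closed j.hom_closed)

text \<open>The commutator \<open>[g^-1, h']\<close> is the inverse of \<open>[g, h']\<close>
  conjugated by \<open>g^-1\<close>, and likewise with the bars exchanged. By
  \<open>symm g h\<close> the same element is conjugated in both cases.\<close>

lemma symm_inv_iff:
  assumes "g \<in> carrier F" "h \<in> carrier F" "symm g h"
  shows "symm (inv g) h \<longleftrightarrow> conj_agree (inv g) (mixed g h)"
  using assms by (simp add: symm_def conj_agree_def mixed_def K.commutator_inv_left
      inj_on_eq_iff[OF K.inv_inj])

text \<open>Put \<open>u = i g\<close> and \<open>v = j g\<close>. Conjugating the hypothesis by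
  \<open>v u = u v\<close> gives the claim, because \<open>(v u) u^-1 = v\<close> and
  \<open>(u v) v^-1 = u\<close>.\<close>

lemma conj_agree_inv:
  assumes g: "g \<in> carrier F" "selfcomm g" and c: "c \<in> carrier K" "conj_agree (inv g) c"
  shows "conj_agree g c"
proof -
  let ?u = "i g" and ?v = "j g"
  have "conj_by K ?v c = conj_by K (?v \<otimes>\<^bsub>K\<^esub> ?u) (conj_by K (inv\<^bsub>K\<^esub> ?u) c)"
    using g(1) c(1) by (simp add: K.conj_by_conj_by K.m_assoc)
  also have "\<dots> = conj_by K (?u \<otimes>\<^bsub>K\<^esub> ?v) (conj_by K (inv\<^bsub>K\<^esub> ?v) c)"
    using g c by (simp add: selfcomm_def conj_agree_def)
  also have "\<dots> = conj_by K ?u c"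
    using g(1) c(1) by (simp add: K.conj_by_conj_by K.m_assoc)
  finally show ?thesis by (simp add: conj_agree_def)
qed

section \<open>Nielsen moves and conjugation of pairs\<close>

definition balanced :: "'f \<Rightarrow> 'f \<Rightarrow> bool" where
  "balanced g h \<longleftrightarrow> symm g h \<and> symm (inv g) h"

lemma balanced_conj_agree:
  assumes "g \<in> carrier F" "h \<in> carrier F" "selfcomm g" "balanced g h"
  shows "conj_agree g (mixed g h)" "conj_agree (inv g) (mixed g h)"
  using assms symm_inv_iff[of g h] conj_agree_inv[of g "mixed g h"] by (auto simp: balanced_def)

lemma balanced_inv:
  assumes "g \<in> carrier F" "balanced g h"
  shows "balanced (inv g) h"
  using assms by (simp add: balanced_def)

text \<open>Since \<open>[g, s']\<close> and \<open>[g', s]\<close> are trivial, a factor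
  \<open>s\<close> to the right of \<open>h\<close> disappears when the commutators are expanded. A
  factor to the left of \<open>h\<close> conjugates \<open>[g, h']\<close> by \<open>s'\<close> and
  \<open>[g', h]\<close> by \<open>s\<close>, whence the extra condition.\<close>

lemma symm_mult_commuting:
  assumes c: "g \<in> carrier F" "h \<in> carrier F" "s \<in> carrier F"
    and s: "i g \<otimes>\<^bsub>K\<^esub> j s = j s \<otimes>\<^bsub>K\<^esub> i g" "j g \<otimes>\<^bsub>K\<^esub> i s = i s \<otimes>\<^bsub>K\<^esub> j g"
    and gh: "symm g h"
  shows "symm g (h \<otimes> s)" "conj_agree s (mixed g h) \<Longrightarrow> symm g (s \<otimes> h)"
proof -
  have "commutator K (i g) (j s) = \<one>\<^bsub>K\<^esub>" "commutator K (j g) (i s) = \<one>\<^bsub>K\<^esub>"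
    using c s by (auto simp: K.commutator_eq_one_iff)
  then show "symm g (h \<otimes> s)" "conj_agree s (mixed g h) \<Longrightarrow> symm g (s \<otimes> h)"
    using c gh by (simp_all add: symm_def mixed_def conj_agree_def K.commutator_mult_right)
qed

lemma selfcomm_commute:
  assumes "g \<in> carrier F" "selfcomm g" "s \<in> {g, inv g}"
  shows "i g \<otimes>\<^bsub>K\<^esub> j s = j s \<otimes>\<^bsub>K\<^esub> i g" "j g \<otimes>\<^bsub>K\<^esub> i s = i s \<otimes>\<^bsub>K\<^esub> j g"
  using assms by (auto simp: selfcomm_def K.commute_inv_right)

lemma balanced_mult_self:
  assumes c: "g \<in> carrier F" "h \<in> carrier F" "selfcomm g" "balanced g h" and s: "s \<in> {g, inv g}"
  shows "balanced g (h \<otimes> s)" "balanced g (s \<otimes> h)"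
proof -
  \<comment> \<open>The claim is made for arbitrary \<open>g\<close> because \<open>balanced\<close>
    requires it at both \<open>g\<close> and \<open>g^-1\<close>.\<close>
  have "symm g (h \<otimes> s) \<and> symm g (s \<otimes> h)"
    if "g \<in> carrier F" "selfcomm g" "balanced g h" "s \<in> {g, inv g}" for g
    using that c(2) symm_mult_commuting[of g h s] selfcomm_commute[of g s] balanced_conj_agree[of g h]
    by (auto simp: balanced_def)
  from this[of g] this[of "inv g"] show "balanced g (h \<otimes> s)" "balanced g (s \<otimes> h)"
    using c s balanced_inv[of g h] selfcomm_inv[of g] by (auto simp: balanced_def)
qed

text \<open>
  By \<open>selfcomm_inv_mult_iff\<close>, a base pair is a pair \<open>x\<close>, \<open>y\<close> such that \<open>x\<close>, \<open>y\<close>, \<open>xy\<close>, \<open>xy\<^sup>-\<^sup>1\<close>,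
  \<open>x\<^sup>-\<^sup>1y\<close> and \<open>yx\<close> commute with their copies. This notion is stable under Nielsen moves, hence
  under simultaneous conjugation of \<open>x\<close> and \<open>y\<close> by elements that they generate.
\<close>

definition base_pair :: "'f \<Rightarrow> 'f \<Rightarrow> bool" where
  "base_pair x y \<longleftrightarrow> x \<in> carrier F \<and> y \<in> carrier F \<and> selfcomm x \<and> selfcomm y
     \<and> balanced x y \<and> balanced x (inv y)"

lemma base_pair_swap:
  assumes "base_pair x y"
  shows "base_pair y x"
  using assms by (simp add: base_pair_def balanced_def symm_swap)

text \<open>That \<open>s y\<close> and \<open>y s\<close> commute with their copies follows from
  \<open>s y = (s^-1)^-1 y\<close> and from \<open>y s\<close> being the inverse of
  \<open>s^-1 y^-1\<close>. The conditions on commutators come from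
  \<open>balanced_mult_self\<close>, applied to \<open>y\<close> and \<open>s\<close> and also to
  \<open>y^-1\<close> and \<open>s^-1\<close>.\<close>

lemma base_pair_mult:
  assumes xy: "base_pair x y" and s: "s \<in> {x, inv x}"
  shows "base_pair x (s \<otimes> y)" "base_pair x (y \<otimes> s)"
proof -
  have c: "x \<in> carrier F" "y \<in> carrier F" "s \<in> carrier F" "selfcomm x" "selfcomm y" "selfcomm s"
    "balanced x y" "balanced x (inv y)" "inv s \<in> {x, inv x}"
    using xy s selfcomm_inv[of x] by (auto simp: base_pair_def)
  have "symm (inv s) y" "symm s (inv y)"
    using c s by (auto simp: balanced_def)
  then have "selfcomm (s \<otimes> y)" "selfcomm (inv (inv s \<otimes> inv y))"
    using selfcomm_inv_mult_iff[of "inv s" y] selfcomm_inv_mult_iff[of s "inv y"]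
      selfcomm_inv[of "inv s \<otimes> inv y"] selfcomm_inv[of s] selfcomm_inv[of y] c
    by auto
  then show "base_pair x (s \<otimes> y)" "base_pair x (y \<otimes> s)"
    using c s balanced_mult_self[of x y s] balanced_mult_self[of x "inv y" "inv s"]
    by (auto simp: base_pair_def F.inv_mult_group)
qed

text \<open>Conjugation by \<open>s\<close> fixes \<open>x\<close> and takes \<open>y\<close> to
  \<open>s y s^-1\<close>, which is two Nielsen moves. As \<open>s'\<close> commutes with
  \<open>x\<close>, conjugating \<open>[x, y']\<close> by \<open>s'\<close> changes only
  \<open>y'\<close>; then \<open>balanced_conj_agree\<close> allows \<open>s\<close> in place of
  \<open>s'\<close>.\<close>

lemma base_pair_conj_by:
  assumes xy: "base_pair x y" and s: "s \<in> {x, inv x}"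
  shows "base_pair (conj_by F s x) (conj_by F s y)"
    and "mixed (conj_by F s x) (conj_by F s y) = conj_by K (i s) (mixed x y)"
    and "mixed (conj_by F s x) (conj_by F s y) = conj_by K (j s) (mixed x y)"
proof -
  have c: "x \<in> carrier F" "y \<in> carrier F" "s \<in> carrier F" "selfcomm x" "balanced x y"
    "inv s \<in> {x, inv x}"
    using xy s by (auto simp: base_pair_def)
  have sx: "conj_by F s x = x"
    using c s by (auto intro!: F.conj_by_eq_self)
  show "base_pair (conj_by F s x) (conj_by F s y)"
    unfolding sx unfolding conj_by_def
    using base_pair_mult(2)[OF base_pair_mult(1)[OF xy s] c(6)] .
  have "conj_by K (j s) (i x) = i x"
    using c s selfcomm_commute[of x s] by (intro K.conj_by_eq_self) auto
  then show j: "mixed (conj_by F s x) (conj_by F s y) = conj_by K (j s) (mixed x y)"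
    using c unfolding sx by (simp add: mixed_def K.conj_by_commutator) (simp add: conj_by_def)
  show "mixed (conj_by F s x) (conj_by F s y) = conj_by K (i s) (mixed x y)"
    using balanced_conj_agree[of x y] c s unfolding j by (auto simp: conj_agree_def)
qed

lemma inv_mixed:
  assumes "g \<in> carrier F" "h \<in> carrier F" "symm g h"
  shows "inv\<^bsub>K\<^esub> (mixed g h) = mixed h g"
  using assms by (simp add: mixed_def symm_def K.inv_commutator)

text \<open>For \<open>s\<close> equal to \<open>y\<close> or \<open>y^-1\<close> the pair is
  swapped, at the cost of inverting \<open>mixed x y\<close>.\<close>

lemma base_pair_conj_by':
  assumes xy: "base_pair x y" and s: "s \<in> {x, inv x, y, inv y}"
  shows "base_pair (conj_by F s x) (conj_by F s y)
    \<and> mixed (conj_by F s x) (conj_by F s y) = conj_by K (i s) (mixed x y)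
    \<and> mixed (conj_by F s x) (conj_by F s y) = conj_by K (j s) (mixed x y)"
proof (cases "s \<in> {x, inv x}")
  case True
  then show ?thesis using base_pair_conj_by[OF xy] by blast
next
  case False
  then have s: "s \<in> {y, inv y}" using s by auto
  note yx = base_pair_conj_by[OF base_pair_swap[OF xy] s]
  have inv: "mixed x y = inv\<^bsub>K\<^esub> (mixed y x)" if "base_pair y x" for x y
    using that by (simp add: inv_mixed base_pair_def balanced_def)
  have "s \<in> carrier F" "x \<in> carrier F" "y \<in> carrier F"
    using xy s by (auto simp: base_pair_def)
  then show ?thesis
    using yx base_pair_swap[OF yx(1)] inv[OF yx(1)] inv[OF base_pair_swap[OF xy]]
    by (simp add: K.conj_by_inv)
qed

text \<open>The two equations together say that \<open>i g\<close> and \<open>j g\<close> conjugate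
  \<open>mixed x y\<close> alike. The first conjunct is carried along so that the lemma for a single
  letter applies to the conjugated pair.\<close>

lemma base_pair_conj_by_generate:
  assumes xy: "base_pair x y" and g: "g \<in> generate F {x, y}"
  shows "base_pair (conj_by F g x) (conj_by F g y)
    \<and> mixed (conj_by F g x) (conj_by F g y) = conj_by K (i g) (mixed x y)
    \<and> mixed (conj_by F g x) (conj_by F g y) = conj_by K (j g) (mixed x y)"
    (is "?P g")
proof -
  have c: "x \<in> carrier F" "y \<in> carrier F" using xy by (auto simp: base_pair_def)
  then have xy_sub: "{x, y} \<subseteq> carrier F" by simp
  have step: "?P (w \<otimes> h)" if w: "w \<in> carrier F" "?P w" and h: "h \<in> {x, inv x, y, inv y}" for w h
  proof -
    \<comment> \<open>Since \<open>w h = ?s w\<close>, and \<open>?s\<close> is a member of the pair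
      conjugated by \<open>w\<close> or the inverse of one, passing from \<open>w\<close> to
      \<open>w h\<close> conjugates that pair by one of its own letters.\<close>
    let ?s = "conj_by F w h"
    have hc: "h \<in> carrier F" using h c by auto
    then have sw: "?s \<otimes> w = w \<otimes> h" "?s \<in> carrier F"
      using w by (simp_all add: conj_by_def F.m_assoc)
    then have i: "i ?s \<otimes>\<^bsub>K\<^esub> i w = i w \<otimes>\<^bsub>K\<^esub> i h" "j ?s \<otimes>\<^bsub>K\<^esub> j w = j w \<otimes>\<^bsub>K\<^esub> j h"
      using w hc by (simp_all flip: i.hom_mult j.hom_mult)
    have "?s \<in> {conj_by F w x, inv (conj_by F w x), conj_by F w y, inv (conj_by F w y)}"
      using h c w by (auto simp: F.conj_by_inv)
    note r = base_pair_conj_by'[OF conjunct1[OF w(2)] this]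
    have F: "conj_by F ?s (conj_by F w z) = conj_by F (w \<otimes> h) z" if "z \<in> carrier F" for z
      using that w(1) sw by (simp add: F.conj_by_conj_by)
    have "conj_by K (i ?s) (conj_by K (i w) (mixed x y)) = conj_by K (i (w \<otimes> h)) (mixed x y)"
      "conj_by K (j ?s) (conj_by K (j w) (mixed x y)) = conj_by K (j (w \<otimes> h)) (mixed x y)"
      using w(1) sw(2) hc c i by (simp_all add: K.conj_by_conj_by)
    then show ?thesis
      using r conjunct1[OF conjunct2[OF w(2)]] conjunct2[OF conjunct2[OF w(2)]]
      unfolding F[OF c(1)] F[OF c(2)] by (metis (no_types))
  qed
  show ?thesis
    using g xy_sub
  proof (induction rule: F.generate_right_induct)
    case one
    then show ?case using xy c by simp
  next
    case (mult w h)
    then show ?case by (intro step) auto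
  next
    case (mult_inv w h)
    then show ?case by (intro step) auto
  qed
qed

section \<open>The centraliser in \<open>K\<close> of all elements
  \<open>j(g)^-1 i(g)\<close>\<close>

definition invariant :: "'k \<Rightarrow> bool" where
  "invariant c \<longleftrightarrow> c \<in> carrier K \<and> (\<forall>g\<in>carrier F. conj_agree g c)"

lemma invariant_one: "invariant \<one>\<^bsub>K\<^esub>"
  by (simp add: invariant_def conj_agree_def)

lemma invariant_mult: "\<lbrakk>invariant c; invariant d\<rbrakk> \<Longrightarrow> invariant (c \<otimes>\<^bsub>K\<^esub> d)"
  by (simp add: invariant_def conj_agree_def K.conj_by_mult)

lemma invariant_inv: "invariant c \<Longrightarrow> invariant (inv\<^bsub>K\<^esub> c)"
  by (simp add: invariant_def conj_agree_def K.conj_by_inv)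

text \<open>Exchange \<open>i\<close> for \<open>j\<close> on the whole product \<open>h g\<close>,
  and then \<open>j\<close> back for \<open>i\<close> on the factor \<open>g\<close> alone.\<close>

lemma invariant_conj_by:
  assumes "invariant c" "g \<in> carrier F"
  shows "invariant (conj_by K (i g) c)"
  unfolding invariant_def conj_agree_def
proof (intro conjI ballI)
  fix h assume h: "h \<in> carrier F"
  have "conj_by K (i h) (conj_by K (i g) c) = conj_by K (i (h \<otimes> g)) c"
    using assms h by (simp add: invariant_def K.conj_by_conj_by)
  also have "\<dots> = conj_by K (j (h \<otimes> g)) c"
    using assms h by (simp add: invariant_def conj_agree_def del: i.hom_mult j.hom_mult)
  also have "\<dots> = conj_by K (j h) (conj_by K (j g) c)"
    using assms h by (simp add: invariant_def K.conj_by_conj_by)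
  also have "conj_by K (j g) c = conj_by K (i g) c"
    using assms by (simp add: invariant_def conj_agree_def)
  finally show "conj_by K (i h) (conj_by K (i g) c) = conj_by K (j h) (conj_by K (i g) c)" .
qed (use assms in \<open>simp add: invariant_def\<close>)

text \<open>In the expansions of \<open>[g h, k']\<close> and \<open>[g' h', k]\<close>, one factor
  is conjugated by \<open>g\<close> and by \<open>g'\<close> respectively. Asking that
  \<open>mixed h k\<close> be \<open>invariant\<close> makes these conjugates equal, so that the
  property passes to products.\<close>

definition central_pair :: "'f \<Rightarrow> 'f \<Rightarrow> bool" where
  "central_pair g h \<longleftrightarrow> symm g h \<and> invariant (mixed g h)"

lemma central_pair_swap:
  assumes "g \<in> carrier F" "h \<in> carrier F" "central_pair g h"
  shows "central_pair h g"
  using assms by (metis central_pair_def inv_mixed invariant_inv symm_swap)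

lemma central_pair_self:
  assumes "g \<in> carrier F" "selfcomm g"
  shows "central_pair g g"
proof -
  have "commutator K (i g) (j g) = \<one>\<^bsub>K\<^esub>" "commutator K (j g) (i g) = \<one>\<^bsub>K\<^esub>"
    using assms by (auto simp: K.commutator_eq_one_iff selfcomm_def)
  then show ?thesis
    by (simp add: central_pair_def symm_def mixed_def invariant_one)
qed

lemma central_pair_mult:
  assumes c: "g \<in> carrier F" "h \<in> carrier F" "k \<in> carrier F"
    and gk: "central_pair g k" and hk: "central_pair h k"
  shows "central_pair (g \<otimes> h) k"
proof -
  have m: "mixed (g \<otimes> h) k = conj_by K (i g) (mixed h k) \<otimes>\<^bsub>K\<^esub> mixed g k"
    using c by (simp add: mixed_def K.commutator_mult_left)
  have "conj_by K (i g) (mixed h k) = conj_by K (j g) (mixed h k)"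
    using hk c by (simp add: central_pair_def invariant_def conj_agree_def)
  then have "symm (g \<otimes> h) k"
    using m gk hk c by (simp add: central_pair_def symm_def mixed_def K.commutator_mult_left)
  then show ?thesis
    using m gk hk c by (simp add: central_pair_def invariant_mult invariant_conj_by)
qed

lemma central_pair_inv:
  assumes c: "g \<in> carrier F" "h \<in> carrier F" and gh: "central_pair g h"
  shows "central_pair (inv g) h"
proof -
  have m: "mixed (inv g) h = inv\<^bsub>K\<^esub> (conj_by K (i (inv g)) (mixed g h))"
    using c by (simp add: mixed_def K.commutator_inv_left)
  have "conj_agree (inv g) (mixed g h)"
    using gh c by (simp add: central_pair_def invariant_def)
  then have "symm (inv g) h"
    using gh c symm_inv_iff by (simp add: central_pair_def)
  then show ?thesis
    using gh c unfolding central_pair_def m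
    by (simp add: invariant_inv invariant_conj_by del: i.hom_inv)
qed

lemma central_pair_generate:
  assumes "H \<subseteq> carrier F" "k \<in> carrier F" "\<And>h. h \<in> H \<Longrightarrow> central_pair h k" "g \<in> generate F H"
  shows "central_pair g k"
  using assms(4)
proof (induction rule: generate.induct)
  case one
  have "conj_agree \<one> \<one>\<^bsub>K\<^esub>" by (simp add: conj_agree_def)
  then show ?case
    using assms(2) by (auto simp: central_pair_def symm_def mixed_def commutator_def invariant_one)
next
  case (inv h)
  then show ?case using assms by (blast intro: central_pair_inv)
next
  case (eng g h)
  then show ?case
    using assms F.generate_in_carrier[OF assms(1)] by (blast intro: central_pair_mult)
qed (use assms in auto)

lemma selfcomm_if_base_pair:
  assumes gen: "carrier F = generate F {x, y}" and xy: "base_pair x y"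
    and g: "g \<in> carrier F"
  shows "selfcomm g"
proof -
  have c: "x \<in> carrier F" "y \<in> carrier F" and self: "selfcomm x" "selfcomm y" and "symm x y"
    using xy by (auto simp: base_pair_def balanced_def)
  have "invariant (mixed x y)"
    unfolding invariant_def conj_agree_def
  proof (intro conjI ballI)
    fix g assume "g \<in> carrier F"
    then have "g \<in> generate F {x, y}" using gen by simp
    \<comment> \<open>Both sides equal \<open>mixed\<close> of the pair conjugated by
      \<open>g\<close>.\<close>
    from base_pair_conj_by_generate[OF xy this]
    show "conj_by K (i g) (mixed x y) = conj_by K (j g) (mixed x y)" by (metis (no_types))
  qed (use c in simp)
  then have "central_pair x y"
    using \<open>symm x y\<close> by (simp add: central_pair_def)
  then have base: "central_pair h k" if "h \<in> {x, y}" "k \<in> {x, y}" for h k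
    using that c central_pair_swap[of x y] central_pair_self self by auto
  have sub: "{x, y} \<subseteq> carrier F" using c by simp
  \<comment> \<open>The lemma \<open>central_pair_generate\<close> extends the first argument only,
    so the two arguments are extended in turn, with a swap in between.\<close>
  have "central_pair k h" if "h \<in> {x, y}" "k \<in> carrier F" for h k
    by (rule central_pair_generate[OF sub]) (use base that sub gen in auto)
  then have "central_pair h k" if "h \<in> {x, y}" "k \<in> carrier F" for h k
    using that sub by (blast intro: central_pair_swap)
  then have all: "central_pair h k" if "h \<in> carrier F" "k \<in> carrier F" for h k
    using central_pair_generate[OF sub that(2)] that gen by blast
  have "g \<in> generate F {x, y}" using g gen by simp
  then show ?thesis
  proof (induction rule: generate.induct)
    case one
    then show ?case by (simp add: selfcomm_def)
  next
    case (inv h)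
    then show ?case using c self selfcomm_inv by auto
  next
    case (eng g h)
    then have gh: "g \<in> carrier F" "h \<in> carrier F" using gen by auto
    \<comment> \<open>Written as \<open>(g^-1)^-1 h\<close>, the product \<open>g h\<close> commutes
      with its copy exactly when this identity holds.\<close>
    then have "symm (inv g) h" using all by (simp add: central_pair_def)
    then show ?case
      using selfcomm_inv_mult_iff[of "inv g" h] selfcomm_inv eng gh by simp
  qed (use self in auto)
qed

text \<open>The four \<open>symm\<close> conditions in \<open>base_pair\<close> correspond to
  \<open>x^-1 y\<close>, \<open>x y\<close>, \<open>x^-1 y^-1\<close> and \<open>x y^-1\<close>; the
  third of these is the inverse of \<open>y x\<close>.\<close>

lemma base_pairI:
  assumes "x \<in> carrier F" "y \<in> carrier F"
    and "selfcomm x" "selfcomm y" "selfcomm (x \<otimes> y)" "selfcomm (x \<otimes> inv y)"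
      "selfcomm (inv x \<otimes> y)" "selfcomm (y \<otimes> x)"
  shows "base_pair x y"
proof -
  have "selfcomm (inv x \<otimes> inv y)"
    using assms selfcomm_inv[of "y \<otimes> x"] by (simp add: F.inv_mult_group)
  then show ?thesis
    using assms selfcomm_inv[of x] selfcomm_inv[of y]
      selfcomm_inv_mult_iff[of x y] selfcomm_inv_mult_iff[of "inv x" y]
      selfcomm_inv_mult_iff[of x "inv y"] selfcomm_inv_mult_iff[of "inv x" "inv y"]
    by (simp add: base_pair_def balanced_def)
qed

end

section \<open>Universal properties\<close>

lemma hom_eq_on_generate:
  assumes G: "group G" "group H" and f: "f \<in> hom G H" and g: "g \<in> hom G H" and S: "S \<subseteq> carrier G"
    and eq: "\<And>s. s \<in> S \<Longrightarrow> f s = g s" and x: "x \<in> generate G S"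
  shows "f x = g x"
proof -
  interpret f: group_hom G H f using G f by (simp add: group_hom_def group_hom_axioms_def)
  interpret g: group_hom G H g using G g by (simp add: group_hom_def group_hom_axioms_def)
  show ?thesis
    using x
  proof (induction rule: generate.induct)
    case (inv h)
    then show ?case using S eq by (simp add: subset_iff)
  next
    case (eng h k)
    then show ?case using group.generate_in_carrier[OF G(1) S] by simp
  qed (use eq in simp_all)
qed

definition word_prod :: "('k, 'y) monoid_scheme \<Rightarrow> ('c \<Rightarrow> 'k) \<Rightarrow> 'c list \<Rightarrow> 'k" where
  "word_prod K h w = foldr (\<lambda>x y. h x \<otimes>\<^bsub>K\<^esub> y) w \<one>\<^bsub>K\<^esub>"

lemma word_prod_simps [simp]:
  "word_prod K h [] = \<one>\<^bsub>K\<^esub>"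
  "word_prod K h (x # w) = h x \<otimes>\<^bsub>K\<^esub> word_prod K h w"
  by (simp_all add: word_prod_def)

lemma (in monoid) word_prod_closed:
  "\<lbrakk>h \<in> A \<rightarrow> carrier G; w \<in> lists A\<rbrakk> \<Longrightarrow> word_prod G h w \<in> carrier G"
  by (induction w) auto

lemma (in monoid) word_prod_append:
  "\<lbrakk>h \<in> A \<rightarrow> carrier G; u \<in> lists A; v \<in> lists A\<rbrakk>
    \<Longrightarrow> word_prod G h (u @ v) = word_prod G h u \<otimes> word_prod G h v"
proof (induction u)
  case (Cons x u)
  then have "h x \<in> carrier G" "word_prod G h u \<in> carrier G" "word_prod G h v \<in> carrier G"
    using word_prod_closed[of h A] by auto
  then show ?case
    using Cons by (simp add: m_assoc)
qed (use word_prod_closed[of h A v] in auto)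

text \<open>Free groups and free products are both instances of \<open>word_monoid\<close>, so this
  common universal property yields theirs.\<close>

lemma (in monoid) word_monoid_hom_exists:
  assumes h: "h \<in> A \<rightarrow> carrier G"
    and R: "\<And>u v. \<lbrakk>(u, v) \<in> R; u \<in> lists A; v \<in> lists A\<rbrakk> \<Longrightarrow> word_prod G h u = word_prod G h v"
  obtains \<psi> where "\<psi> \<in> hom (word_monoid A R) G"
    and "\<And>u. u \<in> lists A \<Longrightarrow> \<psi> (word_cong A R `` {u}) = word_prod G h u"
proof -
  have cong: "word_prod G h u = word_prod G h v" if "(u, v) \<in> word_cong A R" for u v
    using that
  proof (induction rule: word_cong.induct)
    case (step u v p q)
    then show ?case
      using R[of u v] by (simp add: word_prod_append[OF h])
  qed auto
  \<comment> \<open>A class is evaluated at an arbitrary representative; by \<open>cong\<close> the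
    choice does not matter.\<close>
  define \<psi> where "\<psi> U = word_prod G h (SOME u. u \<in> U)" for U
  have \<psi>: "\<psi> (word_cong A R `` {u}) = word_prod G h u" if "u \<in> lists A" for u
  proof -
    have "(SOME v. v \<in> word_cong A R `` {u}) \<in> word_cong A R `` {u}"
      by (rule someI[where x = u]) (use that in \<open>auto intro: word_cong.refl\<close>)
    then show ?thesis by (simp add: \<psi>_def cong)
  qed
  have "\<psi> \<in> hom (word_monoid A R) G"
  proof (rule homI)
    fix U assume "U \<in> carrier (word_monoid A R)"
    then show "\<psi> U \<in> carrier G"
      by (elim word_monoid_carrierE) (simp add: \<psi> word_prod_closed[OF h])
  next
    fix U V assume "U \<in> carrier (word_monoid A R)" "V \<in> carrier (word_monoid A R)"
    then show "\<psi> (U \<otimes>\<^bsub>word_monoid A R\<^esub> V) = \<psi> U \<otimes> \<psi> V"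
      by (elim word_monoid_carrierE)
        (simp add: \<psi> word_monoid_mult word_prod_append[OF h])
  qed
  then show thesis using \<psi> by (rule that)
qed

section \<open>Free groups\<close>

lemma word_elt_closed: "w \<in> lists (letters X) \<Longrightarrow> word_elt X w \<in> carrier (free_group X)"
  by (simp add: word_elt_def free_group_def word_monoid_closed)

lemma word_elt_append:
  "\<lbrakk>u \<in> lists (letters X); v \<in> lists (letters X)\<rbrakk>
    \<Longrightarrow> word_elt X u \<otimes>\<^bsub>free_group X\<^esub> word_elt X v = word_elt X (u @ v)"
  by (simp add: word_elt_def free_group_def word_monoid_mult)

lemma word_elt_Nil: "word_elt X [] = \<one>\<^bsub>free_group X\<^esub>"
  by (simp add: word_elt_def free_group_def word_monoid_one)

lemma word_elt_Cons:
  "\<lbrakk>l \<in> letters X; w \<in> lists (letters X)\<rbrakk>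
    \<Longrightarrow> word_elt X (l # w) = word_elt X [l] \<otimes>\<^bsub>free_group X\<^esub> word_elt X w"
  by (simp add: word_elt_append)

lemma word_elt_Neg:
  assumes "x \<in> X"
  shows "word_elt X [Neg x] = inv\<^bsub>free_group X\<^esub> (word_elt X [Pos x])"
proof -
  interpret group "free_group X" by (rule group_free_group)
  have x: "[Neg x] \<in> lists (letters X)" "[Pos x] \<in> lists (letters X)"
    using assms by (auto simp: letters_def)
  have "([Neg x, Pos x], []) \<in> word_cong (letters X) (cancellations X)"
    using assms x by (intro word_cong_base) (auto simp: cancellations_def)
  then have "word_elt X [Neg x, Pos x] = word_elt X []"
    unfolding word_elt_def by (rule equiv_class_eq[OF equiv_word_cong])
  then have "word_elt X [Neg x] \<otimes>\<^bsub>free_group X\<^esub> word_elt X [Pos x] = \<one>\<^bsub>free_group X\<^esub>"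
    using x by (simp add: word_elt_append word_elt_Nil)
  then show ?thesis
    using x by (metis inv_equality word_elt_closed)
qed

lemma free_group_carrierE:
  assumes "g \<in> carrier (free_group X)"
  obtains w where "w \<in> lists (letters X)" "g = word_elt X w"
  using assms unfolding free_group_def word_elt_def by (rule word_monoid_carrierE)

lemma letters_cases:
  assumes "l \<in> letters X"
  obtains x where "x \<in> X" "l = Pos x" | x where "x \<in> X" "l = Neg x"
  using assms by (auto simp: letters_def)

lemma free_group_generate:
  "carrier (free_group X) = generate (free_group X) ((\<lambda>x. word_elt X [Pos x]) ` X)"
proof
  interpret group "free_group X" by (rule group_free_group)
  show "generate (free_group X) ((\<lambda>x. word_elt X [Pos x]) ` X) \<subseteq> carrier (free_group X)"
    by (intro generate_incl) (auto intro!: word_elt_closed simp: letters_def)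
  have "word_elt X w \<in> generate (free_group X) ((\<lambda>x. word_elt X [Pos x]) ` X)"
    if "w \<in> lists (letters X)" for w
    using that
  proof (induction w)
    case Nil
    then show ?case by (simp add: word_elt_Nil generate.one)
  next
    case (Cons l w)
    have "word_elt X [l] \<in> generate (free_group X) ((\<lambda>x. word_elt X [Pos x]) ` X)"
      using Cons.hyps(1)
      by (cases rule: letters_cases) (auto simp: word_elt_Neg intro: generate.incl generate.inv)
    then show ?case
      using Cons by (subst word_elt_Cons) (auto intro: generate.eng)
  qed
  then show "carrier (free_group X) \<subseteq> generate (free_group X) ((\<lambda>x. word_elt X [Pos x]) ` X)"
    by (auto elim!: free_group_carrierE)
qed

lemma (in group) free_group_hom_exists:
  assumes f: "f \<in> X \<rightarrow> carrier G"
  obtains \<psi> where "\<psi> \<in> hom (free_group X) G" "\<And>x. x \<in> X \<Longrightarrow> \<psi> (word_elt X [Pos x]) = f x"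
proof -
  define h where "h l = (case l of Pos x \<Rightarrow> f x | Neg x \<Rightarrow> inv (f x))" for l
  have h: "h \<in> letters X \<rightarrow> carrier G"
    using f by (auto simp: h_def letters_def Pi_iff)
  have R: "word_prod G h u = word_prod G h v" if "(u, v) \<in> cancellations X" for u v
    using that f by (auto simp: cancellations_def h_def Pi_iff)
  obtain \<psi> where \<psi>: "\<psi> \<in> hom (word_monoid (letters X) (cancellations X)) G"
    "\<And>u. u \<in> lists (letters X) \<Longrightarrow>
      \<psi> (word_cong (letters X) (cancellations X) `` {u}) = word_prod G h u"
    using word_monoid_hom_exists[OF h R] by blast
  show thesis
  proof (rule that)
    show "\<psi> \<in> hom (free_group X) G" using \<psi>(1) by (simp add: free_group_def)
    show "\<psi> (word_elt X [Pos x]) = f x" if "x \<in> X" for x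
      using that f \<psi>(2)[of "[Pos x]"] by (auto simp: word_elt_def letters_def h_def Pi_iff)
  qed
qed

text \<open>For \<open>m\<close> equal to \<open>Inl\<close> or \<open>Inr\<close> the renamed word
  is \<open>plain_word w\<close> or \<open>bar_word w\<close>. Values of \<open>i\<close>,
  \<open>j\<close>, \<open>chi_elt\<close> and \<open>chi_bar\<close> at words thus become values of
  one homomorphism on the free group on \<open>gens4 a b\<close>, where the relators live.\<close>

lemma hom_map_word_elt:
  assumes K: "group K" and f: "f \<in> hom (free_group X) K" and g: "g \<in> hom (free_group Y) K"
    and m: "m ` X \<subseteq> Y" and fg: "\<And>x. x \<in> X \<Longrightarrow> f (word_elt X [Pos x]) = g (word_elt Y [Pos (m x)])"
    and w: "w \<in> lists (letters X)"
  shows "f (word_elt X w) = g (word_elt Y (map (map_letter m) w))"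
    and "map (map_letter m) w \<in> lists (letters Y)"
proof -
  interpret f: group_hom "free_group X" K f
    using K f group_free_group by (simp add: group_hom_def group_hom_axioms_def)
  interpret g: group_hom "free_group Y" K g
    using K g group_free_group by (simp add: group_hom_def group_hom_axioms_def)
  have letter: "map_letter m l \<in> letters Y \<and> f (word_elt X [l]) = g (word_elt Y [map_letter m l])"
    if "l \<in> letters X" for l
    using that
  proof (cases rule: letters_cases)
    case (1 x)
    then show ?thesis using m fg by (auto simp: letters_def)
  next
    case (2 x)
    then have "word_elt X [Pos x] \<in> carrier (free_group X)"
      "word_elt Y [Pos (m x)] \<in> carrier (free_group Y)" "m x \<in> Y"
      using m by (auto intro!: word_elt_closed simp: letters_def)
    then show ?thesis using 2 fg by (auto simp: letters_def word_elt_Neg)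
  qed
  then show lists: "map (map_letter m) w \<in> lists (letters Y)"
    using w by auto
  show "f (word_elt X w) = g (word_elt Y (map (map_letter m) w))"
    using w
  proof (induction w)
    case Nil
    then show ?case by (simp add: word_elt_Nil)
  next
    case (Cons l w)
    then have "word_elt X [l] \<in> carrier (free_group X)" "word_elt X w \<in> carrier (free_group X)"
      "word_elt Y [map_letter m l] \<in> carrier (free_group Y)"
      "word_elt Y (map (map_letter m) w) \<in> carrier (free_group Y)"
      using letter by (auto intro!: word_elt_closed)
    moreover have "word_elt X (l # w) = word_elt X [l] \<otimes>\<^bsub>free_group X\<^esub> word_elt X w"
      using Cons by (intro word_elt_Cons) auto
    moreover have "word_elt Y (map_letter m l # map (map_letter m) w)
        = word_elt Y [map_letter m l] \<otimes>\<^bsub>free_group Y\<^esub> word_elt Y (map (map_letter m) w)"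
      using Cons letter by (intro word_elt_Cons) auto
    ultimately show ?case using Cons letter by simp
  qed
qed

section \<open>Free products\<close>

lemma word_cong_class_eq:
  "\<lbrakk>(u, v) \<in> R; u \<in> lists A; v \<in> lists A\<rbrakk> \<Longrightarrow> word_cong A R `` {u} = word_cong A R `` {v}"
  by (rule equiv_class_eq[OF equiv_word_cong word_cong_base])

lemma product_inl_hom: "product_inl G H \<in> hom G (free_product G H)" if "group G"
proof -
  interpret group G by fact
  show ?thesis
  proof (rule homI)
    fix x y assume "x \<in> carrier G" "y \<in> carrier G"
    then show "product_inl G H (x \<otimes>\<^bsub>G\<^esub> y) = product_inl G H x \<otimes>\<^bsub>free_product G H\<^esub> product_inl G H y"
      using word_cong_class_eq[of "[Inl x, Inl y]" "[Inl (x \<otimes>\<^bsub>G\<^esub> y)]" "product_moves G H"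
          "carrier G <+> carrier H"]
      by (simp add: product_inl_def free_product_def word_monoid_mult InlI InrI)
        (auto simp: product_moves_def)
  qed (auto simp: product_inl_def free_product_def intro!: word_monoid_closed)
qed

lemma product_inr_hom: "product_inr G H \<in> hom H (free_product G H)" if "group H"
proof -
  interpret group H by fact
  show ?thesis
  proof (rule homI)
    fix x y assume "x \<in> carrier H" "y \<in> carrier H"
    then show "product_inr G H (x \<otimes>\<^bsub>H\<^esub> y) = product_inr G H x \<otimes>\<^bsub>free_product G H\<^esub> product_inr G H y"
      using word_cong_class_eq[of "[Inr x, Inr y]" "[Inr (x \<otimes>\<^bsub>H\<^esub> y)]" "product_moves G H"
          "carrier G <+> carrier H"]
      by (simp add: product_inr_def free_product_def word_monoid_mult InlI InrI)
        (auto simp: product_moves_def)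
  qed (auto simp: product_inr_def free_product_def intro!: word_monoid_closed)
qed

lemma free_product_generate:
  assumes "group G" "group H"
  shows "carrier (free_product G H)
    = generate (free_product G H) (product_inl G H ` carrier G \<union> product_inr G H ` carrier H)"
    (is "_ = generate ?P ?S")
proof
  interpret group ?P using assms by (rule group_free_product)
  show "generate ?P ?S \<subseteq> carrier ?P"
    using product_inl_hom[OF assms(1), of H] product_inr_hom[OF assms(2), of G]
    by (intro generate_incl) (auto simp: hom_def)
  let ?c = "\<lambda>w. word_cong (carrier G <+> carrier H) (product_moves G H) `` {w}"
  have "?c w \<in> generate ?P ?S" if "w \<in> lists (carrier G <+> carrier H)" for w
    using that
  proof (induction w)
    case Nil
    have "?c [] = \<one>\<^bsub>?P\<^esub>" by (simp add: free_product_def word_monoid_one)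
    then show ?case using generate.one[of ?P ?S] by metis
  next
    case (Cons l w)
    have "?c [l] \<in> ?S"
      using Cons.hyps(1) by (auto simp: product_inl_def product_inr_def)
    moreover have "?c (l # w) = ?c [l] \<otimes>\<^bsub>?P\<^esub> ?c w"
      using Cons by (simp add: free_product_def word_monoid_mult)
    ultimately show ?case
      using Cons.IH by (metis generate.incl generate.eng)
  qed
  then show "carrier ?P \<subseteq> generate ?P ?S"
    unfolding free_product_def by (auto elim!: word_monoid_carrierE)
qed

lemma (in group) free_product_hom_exists:
  assumes "group H1" "group H2" and f: "f \<in> hom H1 G" and g: "g \<in> hom H2 G"
  obtains \<psi> where "\<psi> \<in> hom (free_product H1 H2) G"
    and "\<And>x. x \<in> carrier H1 \<Longrightarrow> \<psi> (product_inl H1 H2 x) = f x"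
    and "\<And>y. y \<in> carrier H2 \<Longrightarrow> \<psi> (product_inr H1 H2 y) = g y"
proof -
  interpret f: group_hom H1 G f
    using assms is_group by (simp add: group_hom_def group_hom_axioms_def)
  interpret g: group_hom H2 G g
    using assms is_group by (simp add: group_hom_def group_hom_axioms_def)
  let ?A = "carrier H1 <+> carrier H2" and ?R = "product_moves H1 H2"
  have h: "case_sum f g \<in> ?A \<rightarrow> carrier G"
    by auto
  have R: "word_prod G (case_sum f g) u = word_prod G (case_sum f g) v" if "(u, v) \<in> ?R" for u v
    using that by (auto simp: product_moves_def m_assoc)
  obtain \<psi> where \<psi>: "\<psi> \<in> hom (word_monoid ?A ?R) G"
    "\<And>u. u \<in> lists ?A \<Longrightarrow> \<psi> (word_cong ?A ?R `` {u}) = word_prod G (case_sum f g) u"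
    using word_monoid_hom_exists[OF h R] by blast
  show thesis
  proof (rule that)
    show "\<psi> \<in> hom (free_product H1 H2) G" using \<psi>(1) by (simp add: free_product_def)
    show "\<psi> (product_inl H1 H2 x) = f x" if "x \<in> carrier H1" for x
      using that \<psi>(2)[of "[Inl x]"] by (simp add: product_inl_def InlI)
    show "\<psi> (product_inr H1 H2 y) = g y" if "y \<in> carrier H2" for y
      using that \<psi>(2)[of "[Inr y]"] by (simp add: product_inr_def InrI)
  qed
qed

section \<open>Quotients by normal closures\<close>

context group
begin

lemma normal_closure_normal:
  assumes "S \<subseteq> carrier G"
  shows "normal_closure G S \<lhd> G"
proof -
  let ?N = "{N. N \<lhd> G \<and> S \<subseteq> N}"
  \<comment> \<open>This member of the family keeps the intersection from ranging over the empty
    family.\<close>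
  have "carrier G \<lhd> G"
    by (simp add: normal_inv_iff subgroup_self)
  then have "?N \<noteq> {}" using assms by blast
  then have "subgroup (\<Inter>?N) G"
    by (intro subgroups_Inter) (auto intro: normal_imp_subgroup)
  then show ?thesis
    unfolding normal_closure_def by (auto simp: normal_inv_iff)
qed

lemma normal_closure_incl: "S \<subseteq> normal_closure G S"
  by (auto simp: normal_closure_def)

lemma group_Mod_normal_closure:
  "S \<subseteq> carrier G \<Longrightarrow> group (G Mod normal_closure G S)"
  by (intro normal.factorgroup_is_group normal_closure_normal)

lemma Mod_normal_closure_hom:
  "S \<subseteq> carrier G \<Longrightarrow> (\<lambda>g. normal_closure G S #> g) \<in> hom G (G Mod normal_closure G S)"
  by (intro normal.r_coset_hom_Mod normal_closure_normal)

lemma Mod_normal_closure_one: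
  assumes "S \<subseteq> carrier G" "s \<in> S"
  shows "normal_closure G S #> s = \<one>\<^bsub>G Mod normal_closure G S\<^esub>"
proof -
  have "subgroup (normal_closure G S) G"
    using assms by (intro normal_imp_subgroup normal_closure_normal)
  moreover have "s \<in> normal_closure G S"
    using assms normal_closure_incl by blast
  ultimately show ?thesis
    using assms coset_join2 by auto
qed

text \<open>The kernel of \<open>h\<close> is one of the normal subgroups whose intersection is the
  normal closure, so \<open>h\<close> factors through the quotient.\<close>

lemma Mod_normal_closure_hom_exists:
  assumes "group H" and h: "h \<in> hom G H" and S: "S \<subseteq> carrier G"
    and one: "\<And>s. s \<in> S \<Longrightarrow> h s = \<one>\<^bsub>H\<^esub>"
  obtains \<psi> where "\<psi> \<in> hom (G Mod normal_closure G S) H"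
    and "\<And>x. x \<in> carrier G \<Longrightarrow> \<psi> (normal_closure G S #> x) = h x"
proof -
  interpret h: group_hom G H h
    using assms is_group by (simp add: group_hom_def group_hom_axioms_def)
  have "normal_closure G S \<subseteq> kernel G H h"
    using h.normal_kernel S one by (auto simp: normal_closure_def kernel_def)
  then show thesis
    using h.FactGroup_universal_kernel[OF normal_closure_normal[OF S]] that by blast
qed

lemma Mod_normal_closure_generate:
  assumes "S \<subseteq> carrier G" "T \<subseteq> carrier G" "carrier G = generate G T"
  shows "carrier (G Mod normal_closure G S)
    = generate (G Mod normal_closure G S) ((\<lambda>g. normal_closure G S #> g) ` T)"
proof -
  interpret q: group_hom G "G Mod normal_closure G S" "\<lambda>g. normal_closure G S #> g"
    using assms is_group group_Mod_normal_closure Mod_normal_closure_hom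
    by (simp add: group_hom_def group_hom_axioms_def)
  show ?thesis
    using q.generate_img[OF assms(2)] assms(3) by (simp add: carrier_FactGroup)
qed

end

lemma hom_commutator:
  assumes "group G" "group H" "h \<in> hom G H" "x \<in> carrier G" "y \<in> carrier G"
  shows "h (commutator G x y) = commutator H (h x) (h y)"
proof -
  interpret group_hom G H h
    using assms by (simp add: group_hom_def group_hom_axioms_def)
  show ?thesis using assms by (simp add: commutator_def)
qed

section \<open>The weak commutativity group and its universal property\<close>

context group
begin

lemma chi_relators_subset:
  "{commutator (free_product G G) (product_inl G G g) (product_inr G G g) | g. g \<in> carrier G}
    \<subseteq> carrier (free_product G G)"
proof -
  interpret P: group "free_product G G"
    by (intro group_free_product is_group)
  show ?thesis
    using hom_in_carrier[OF product_inl_hom[OF is_group, of G]]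
      hom_in_carrier[OF product_inr_hom[OF is_group, of G]] by auto
qed

lemma group_chi: "group (chi G)"
  unfolding chi_def chi_kernel_def
  by (intro group.group_Mod_normal_closure group_free_product is_group chi_relators_subset)

lemma chi_quotient_hom: "(\<lambda>u. chi_kernel G #>\<^bsub>free_product G G\<^esub> u) \<in> hom (free_product G G) (chi G)"
  unfolding chi_def chi_kernel_def
  by (intro group.Mod_normal_closure_hom group_free_product is_group chi_relators_subset)

lemma chi_elt_hom: "chi_elt G \<in> hom G (chi G)"
  using Group.hom_compose[OF product_inl_hom[OF is_group, of G] chi_quotient_hom]
  by (simp add: chi_elt_def[abs_def] comp_def)

lemma chi_bar_hom: "chi_bar G \<in> hom G (chi G)"
  using Group.hom_compose[OF product_inr_hom[OF is_group, of G] chi_quotient_hom]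
  by (simp add: chi_bar_def[abs_def] comp_def)

lemma commutator_chi_elt_chi_bar:
  assumes "g \<in> carrier G"
  shows "commutator (chi G) (chi_elt G g) (chi_bar G g) = \<one>\<^bsub>chi G\<^esub>"
proof -
  have "chi_kernel G #>\<^bsub>free_product G G\<^esub>
      commutator (free_product G G) (product_inl G G g) (product_inr G G g) = \<one>\<^bsub>chi G\<^esub>"
    unfolding chi_def chi_kernel_def
    by (intro group.Mod_normal_closure_one group_free_product is_group chi_relators_subset)
      (use assms in auto)
  moreover have "product_inl G G g \<in> carrier (free_product G G)"
    "product_inr G G g \<in> carrier (free_product G G)"
    using assms product_inl_hom[OF is_group, of G] product_inr_hom[OF is_group, of G]
    by (auto simp: hom_def)
  ultimately show ?thesis
    using hom_commutator[OF group_free_product[OF is_group is_group] group_chi chi_quotient_hom]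
    by (simp add: chi_elt_def chi_bar_def)
qed

lemma chi_generate:
  "carrier (chi G) = generate (chi G) (chi_elt G ` carrier G \<union> chi_bar G ` carrier G)"
proof -
  have "product_inl G G ` carrier G \<union> product_inr G G ` carrier G \<subseteq> carrier (free_product G G)"
    using product_inl_hom[OF is_group, of G] product_inr_hom[OF is_group, of G]
    by (auto simp: hom_def)
  from group.Mod_normal_closure_generate[OF group_free_product[OF is_group is_group]
      chi_relators_subset this free_product_generate[OF is_group is_group]]
  show ?thesis
    by (simp add: chi_def chi_kernel_def chi_elt_def[abs_def] chi_bar_def[abs_def] image_Un image_image)
qed

text \<open>The maps \<open>i\<close> and \<open>j\<close> combine to a homomorphism on the free
  product. It kills every \<open>[g, g']\<close> by the commuting hypothesis, and so descends to
  \<open>chi G\<close>.\<close>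

lemma chi_hom_exists:
  assumes K: "group K" and i: "i \<in> hom G K" and j: "j \<in> hom G K"
    and ij: "\<And>g. g \<in> carrier G \<Longrightarrow> i g \<otimes>\<^bsub>K\<^esub> j g = j g \<otimes>\<^bsub>K\<^esub> i g"
  obtains \<psi> where "\<psi> \<in> hom (chi G) K"
    and "\<And>g. g \<in> carrier G \<Longrightarrow> \<psi> (chi_elt G g) = i g"
    and "\<And>g. g \<in> carrier G \<Longrightarrow> \<psi> (chi_bar G g) = j g"
proof -
  interpret K: group K by fact
  have P: "group (free_product G G)"
    by (intro group_free_product is_group)
  obtain \<theta> where \<theta>: "\<theta> \<in> hom (free_product G G) K"
    "\<And>x. x \<in> carrier G \<Longrightarrow> \<theta> (product_inl G G x) = i x"
    "\<And>y. y \<in> carrier G \<Longrightarrow> \<theta> (product_inr G G y) = j y"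
    using K.free_product_hom_exists[OF is_group is_group i j] by blast
  have c: "product_inl G G g \<in> carrier (free_product G G)"
    "product_inr G G g \<in> carrier (free_product G G)" "i g \<in> carrier K" "j g \<in> carrier K"
    if "g \<in> carrier G" for g
    using that product_inl_hom[OF is_group, of G] product_inr_hom[OF is_group, of G] i j
    by (auto simp: hom_def)
  have one: "\<theta> r = \<one>\<^bsub>K\<^esub>"
    if "r \<in> {commutator (free_product G G) (product_inl G G g) (product_inr G G g) | g. g \<in> carrier G}"
    for r
    using that c \<theta> ij
    by (auto simp: hom_commutator[OF P K \<theta>(1)] K.commutator_eq_one_iff)
  obtain \<psi> where "\<psi> \<in> hom (chi G) K"
    "\<And>x. x \<in> carrier (free_product G G) \<Longrightarrow> \<psi> (chi_kernel G #>\<^bsub>free_product G G\<^esub> x) = \<theta> x"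
    using group.Mod_normal_closure_hom_exists[OF P K \<theta>(1) chi_relators_subset one,
        folded chi_kernel_def, folded chi_def] by blast
  with \<theta> c that show thesis by (simp add: chi_elt_def chi_bar_def)
qed

end

section \<open>The presentation\<close>

lemma presentation_generate:
  assumes "R \<subseteq> carrier (free_group X)"
  shows "carrier (presentation X R) = generate (presentation X R) (presentation_gen X R ` X)"
proof -
  have "(\<lambda>x. word_elt X [Pos x]) ` X \<subseteq> carrier (free_group X)"
    by (auto intro!: word_elt_closed simp: letters_def)
  from group.Mod_normal_closure_generate[OF group_free_group assms this free_group_generate]
  show ?thesis
    by (simp add: presentation_def presentation_gen_def[abs_def] image_image)
qed

lemma mem_gens4_iff:
  "s \<in> gens4 a b \<longleftrightarrow> (\<exists>x\<in>{a, b}. s = Inl x \<or> s = Inr x)"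
  by (auto simp: gens4_def)

lemma Upsilon2_lists: "Upsilon2 a b \<subseteq> lists (letters {a, b})"
  by (auto simp: Upsilon2_def letters_def)

lemma plain_bar_word_lists:
  assumes "w \<in> lists (letters {a, b})"
  shows "plain_word w \<in> lists (letters (gens4 a b))" "bar_word w \<in> lists (letters (gens4 a b))"
  using assms by (force simp: plain_word_def bar_word_def letters_def gens4_def)+

lemma relators_subset: "relators a b \<subseteq> carrier (free_group (gens4 a b))"
proof -
  interpret group "free_group (gens4 a b)" by (rule group_free_group)
  show ?thesis
    unfolding relators_def using Upsilon2_lists[of a b]
    by (auto intro!: commutator_closed word_elt_closed plain_bar_word_lists)
qed

text \<open>Here finitely many relators are shown to imply all the others: they make the basis a
  \<open>base_pair\<close>, and \<open>selfcomm_if_base_pair\<close> then covers the whole free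
  group. The conclusion is the hypothesis needed for mapping \<open>chi\<close> to the
  presentation.\<close>

lemma selfcomm_presentation:
  fixes a b :: 'a
  defines "F \<equiv> free_group {a, b}" and "K \<equiv> presentation (gens4 a b) (relators a b)"
  assumes i: "i \<in> hom F K" and j: "j \<in> hom F K"
    and gens: "\<And>x. x \<in> {a, b} \<Longrightarrow>
        i (word_elt {a, b} [Pos x]) = presentation_gen (gens4 a b) (relators a b) (Inl x)"
      "\<And>x. x \<in> {a, b} \<Longrightarrow>
        j (word_elt {a, b} [Pos x]) = presentation_gen (gens4 a b) (relators a b) (Inr x)"
    and g: "g \<in> carrier F"
  shows "i g \<otimes>\<^bsub>K\<^esub> j g = j g \<otimes>\<^bsub>K\<^esub> i g"
proof -
  let ?F4 = "free_group (gens4 a b)" and ?w4 = "word_elt (gens4 a b)"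
  define q where "q u = normal_closure ?F4 (relators a b) #>\<^bsub>?F4\<^esub> u" for u
  have F: "group F" unfolding F_def by (rule group_free_group)
  have F4: "group ?F4" by (rule group_free_group)
  have K: "group K"
    unfolding K_def presentation_def
    by (intro group.group_Mod_normal_closure F4 relators_subset)
  have q: "q \<in> hom ?F4 K"
    unfolding K_def presentation_def q_def[abs_def]
    by (intro group.Mod_normal_closure_hom F4 relators_subset)
  interpret two_copies F K i j
    using F K i j by (simp add: two_copies_def two_copies_axioms_def)
  have words: "i (word_elt {a, b} w) = q (?w4 (plain_word w))"
    "j (word_elt {a, b} w) = q (?w4 (bar_word w))" if "w \<in> lists (letters {a, b})" for w
    unfolding plain_word_def bar_word_def
    by (rule hom_map_word_elt(1)[OF K _ q _ _ that];
        use i j gens in \<open>auto simp: F_def gens4_def q_def presentation_gen_def\<close>)+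
  have sc: "selfcomm (word_elt {a, b} w)" if w: "w \<in> Upsilon2 a b" for w
  proof -
    have l: "w \<in> lists (letters {a, b})" using w Upsilon2_lists[of a b] by blast
    have "commutator ?F4 (?w4 (plain_word w)) (?w4 (bar_word w)) \<in> relators a b"
      using w by (auto simp: relators_def)
    then have "q (commutator ?F4 (?w4 (plain_word w)) (?w4 (bar_word w))) = \<one>\<^bsub>K\<^esub>"
      unfolding q_def K_def presentation_def
      by (intro group.Mod_normal_closure_one F4 relators_subset)
    then have "commutator K (i (word_elt {a, b} w)) (j (word_elt {a, b} w)) = \<one>\<^bsub>K\<^esub>"
      using l by (simp add: words hom_commutator[OF F4 K q] word_elt_closed plain_bar_word_lists)
    then show ?thesis
      using l word_elt_closed[of w "{a, b}"]
      by (simp add: selfcomm_def K.commutator_eq_one_iff F_def)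
  qed
  let ?a = "word_elt {a, b} [Pos a]" and ?b = "word_elt {a, b} [Pos b]"
  have pair: "word_elt {a, b} [l, m] = word_elt {a, b} [l] \<otimes>\<^bsub>F\<^esub> word_elt {a, b} [m]"
    if "l \<in> letters {a, b}" "m \<in> letters {a, b}" for l m
    using that by (simp add: word_elt_append F_def)
  have lets: "Pos a \<in> letters {a, b}" "Pos b \<in> letters {a, b}" "Neg a \<in> letters {a, b}"
    "Neg b \<in> letters {a, b}"
    by (auto simp: letters_def)
  have "base_pair ?a ?b"
    by (rule base_pairI)
      (use sc[of "[Pos a]"] sc[of "[Pos b]"] sc[of "[Pos a, Pos b]"] sc[of "[Pos a, Neg b]"]
        sc[of "[Neg a, Pos b]"] sc[of "[Pos b, Pos a]"] word_elt_closed[of _ "{a, b}"] lets in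
        \<open>simp_all add: Upsilon2_def pair word_elt_Neg flip: F_def\<close>)
  moreover have "carrier F = generate F {?a, ?b}"
    using free_group_generate[of "{a, b}"] by (simp add: F_def)
  ultimately show ?thesis
    using selfcomm_if_base_pair g by (simp add: selfcomm_def)
qed

section \<open>The isomorphism, from two mutually inverse homomorphisms\<close>

theorem mainTheorem6:
  fixes a b :: 'a
  assumes "a \<noteq> b"
  shows "\<exists>\<phi> \<in> iso (presentation (gens4 a b) (relators a b)) (chi (free_group {a, b})).
      \<phi> (presentation_gen (gens4 a b) (relators a b) (Inl a))
        = chi_elt (free_group {a, b}) (word_elt {a, b} [Pos a])
    \<and> \<phi> (presentation_gen (gens4 a b) (relators a b) (Inl b))
        = chi_elt (free_group {a, b}) (word_elt {a, b} [Pos b])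
    \<and> \<phi> (presentation_gen (gens4 a b) (relators a b) (Inr a))
        = chi_bar (free_group {a, b}) (word_elt {a, b} [Pos a])
    \<and> \<phi> (presentation_gen (gens4 a b) (relators a b) (Inr b))
        = chi_bar (free_group {a, b}) (word_elt {a, b} [Pos b])"
proof -
  let ?F = "free_group {a, b}" and ?F4 = "free_group (gens4 a b)"
    and ?K = "presentation (gens4 a b) (relators a b)"
    and ?gen = "presentation_gen (gens4 a b) (relators a b)"
  let ?X = "chi ?F" and ?e = "\<lambda>x. word_elt {a, b} [Pos x]"
  interpret F: group ?F by (rule group_free_group)
  interpret F4: group ?F4 by (rule group_free_group)
  interpret X: group ?X by (rule F.group_chi)
  interpret K: group ?K
    unfolding presentation_def by (intro F4.group_Mod_normal_closure relators_subset)
  have e: "?e x \<in> carrier ?F" if "x \<in> {a, b}" for x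
    using that by (auto intro!: word_elt_closed simp: letters_def)
  have gen_closed: "?gen ` gens4 a b \<subseteq> carrier ?K"
    unfolding presentation_generate[OF relators_subset] by (auto intro: generate.incl)
  have F_gen: "carrier ?F = generate ?F {?e a, ?e b}"
    using free_group_generate[of "{a, b}"] by simp

  \<comment> \<open>The map \<open>\<phi>\<close> is obtained from these images of the generators:
    each relator dies because every element commutes with its copy in \<open>chi\<close>.\<close>
  define t where "t s = case_sum (\<lambda>x. chi_elt ?F (?e x)) (\<lambda>x. chi_bar ?F (?e x)) s" for s
  have t: "t \<in> gens4 a b \<rightarrow> carrier ?X"
    using e hom_in_carrier[OF F.chi_elt_hom] hom_in_carrier[OF F.chi_bar_hom]
    by (auto simp: t_def gens4_def)
  obtain \<theta> where \<theta>: "\<theta> \<in> hom ?F4 ?X" "\<And>x. x \<in> gens4 a b \<Longrightarrow> \<theta> (word_elt (gens4 a b) [Pos x]) = t x"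
    using X.free_group_hom_exists[OF t] by blast
  have words: "chi_elt ?F (word_elt {a, b} w) = \<theta> (word_elt (gens4 a b) (plain_word w))"
    "chi_bar ?F (word_elt {a, b} w) = \<theta> (word_elt (gens4 a b) (bar_word w))"
    if "w \<in> lists (letters {a, b})" for w
    unfolding plain_word_def bar_word_def
    by (rule hom_map_word_elt(1)[OF X.is_group _ \<theta>(1) _ _ that];
        use F.chi_elt_hom F.chi_bar_hom \<theta>(2) in \<open>auto simp: t_def gens4_def\<close>)+
  have "\<theta> r = \<one>\<^bsub>?X\<^esub>" if r: "r \<in> relators a b" for r
  proof -
    obtain w where w: "w \<in> lists (letters {a, b})"
      "r = commutator ?F4 (word_elt (gens4 a b) (plain_word w)) (word_elt (gens4 a b) (bar_word w))"
      using r Upsilon2_lists[of a b] unfolding relators_def by blast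
    then show ?thesis
      using F.commutator_chi_elt_chi_bar[of "word_elt {a, b} w"]
      by (simp add: hom_commutator[OF F4.is_group X.is_group \<theta>(1)] word_elt_closed
          plain_bar_word_lists words)
  qed
  then obtain \<phi> where \<phi>: "\<phi> \<in> hom ?K ?X"
    and \<phi>_q: "\<And>u. u \<in> carrier ?F4 \<Longrightarrow>
      \<phi> (normal_closure ?F4 (relators a b) #>\<^bsub>?F4\<^esub> u) = \<theta> u"
    using F4.Mod_normal_closure_hom_exists[OF X.is_group \<theta>(1) relators_subset]
    unfolding presentation_def by blast
  have \<phi>_gen: "\<phi> (?gen s) = t s" if "s \<in> gens4 a b" for s
  proof -
    have "word_elt (gens4 a b) [Pos s] \<in> carrier ?F4"
      using that by (auto intro!: word_elt_closed simp: letters_def)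
    then show ?thesis
      using \<phi>_q \<theta>(2)[OF that] by (simp add: presentation_gen_def)
  qed

  have \<phi>_Inl: "\<phi> (?gen (Inl x)) = chi_elt ?F (?e x)"
    and \<phi>_Inr: "\<phi> (?gen (Inr x)) = chi_bar ?F (?e x)" if "x \<in> {a, b}" for x
    using that \<phi>_gen[of "Inl x"] \<phi>_gen[of "Inr x"] mem_gens4_iff[of _ a b] by (simp_all add: t_def)

  \<comment> \<open>For the inverse \<open>\<psi>\<close>, the two copies of the basis give
    \<open>i\<close> and \<open>j\<close> by freeness, and \<open>selfcomm_presentation\<close> lets
    both factor through \<open>chi\<close>.\<close>
  have "(\<lambda>x. ?gen (Inl x)) \<in> {a, b} \<rightarrow> carrier ?K"
    using gen_closed by (auto simp: gens4_def)
  then obtain i where i: "i \<in> hom ?F ?K" "\<And>x. x \<in> {a, b} \<Longrightarrow> i (?e x) = ?gen (Inl x)"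
    by (rule K.free_group_hom_exists) blast
  have "(\<lambda>x. ?gen (Inr x)) \<in> {a, b} \<rightarrow> carrier ?K"
    using gen_closed by (auto simp: gens4_def)
  then obtain j where j: "j \<in> hom ?F ?K" "\<And>x. x \<in> {a, b} \<Longrightarrow> j (?e x) = ?gen (Inr x)"
    by (rule K.free_group_hom_exists) blast
  obtain \<psi> where \<psi>: "\<psi> \<in> hom ?X ?K" "\<And>g. g \<in> carrier ?F \<Longrightarrow> \<psi> (chi_elt ?F g) = i g"
    "\<And>g. g \<in> carrier ?F \<Longrightarrow> \<psi> (chi_bar ?F g) = j g"
    using F.chi_hom_exists[OF K.is_group i(1) j(1)]
      selfcomm_presentation[OF i(1) j(1) i(2) j(2)] by blast

  have \<psi>\<phi>: "\<psi> (\<phi> x) = x" if "x \<in> carrier ?K" for x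
  proof -
    have "(\<psi> \<circ> \<phi>) x = id x"
    proof (rule hom_eq_on_generate[where f = "\<psi> \<circ> \<phi>" and g = id, OF K.is_group K.is_group _ _ gen_closed])
      show "(\<psi> \<circ> \<phi>) s = id s" if "s \<in> ?gen ` gens4 a b" for s
        using that e by (auto simp: mem_gens4_iff \<phi>_Inl \<phi>_Inr \<psi> i j)
      show "x \<in> generate ?K (?gen ` gens4 a b)"
        using that presentation_generate[OF relators_subset] by metis
    qed (use Group.hom_compose[OF \<phi> \<psi>(1)] in \<open>auto simp: hom_def\<close>)
    then show ?thesis by simp
  qed
  have sub: "{?e a, ?e b} \<subseteq> carrier ?F" using e by simp
  \<comment> \<open>The generating set of \<open>chi\<close> in \<open>chi_generate\<close> consists
    of the copies of all elements of the free group, so agreement is first extended from the basis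
    to all \<open>g\<close>.\<close>
  have \<phi>i: "(\<phi> \<circ> i) g = chi_elt ?F g" if "g \<in> carrier ?F" for g
    by (rule hom_eq_on_generate[OF F.is_group X.is_group Group.hom_compose[OF i(1) \<phi>] F.chi_elt_hom sub])
      (use that F_gen in \<open>auto simp: i \<phi>_Inl\<close>)
  have \<phi>j: "(\<phi> \<circ> j) g = chi_bar ?F g" if "g \<in> carrier ?F" for g
    by (rule hom_eq_on_generate[OF F.is_group X.is_group Group.hom_compose[OF j(1) \<phi>] F.chi_bar_hom sub])
      (use that F_gen in \<open>auto simp: j \<phi>_Inr\<close>)
  have \<phi>\<psi>: "\<phi> (\<psi> y) = y" if "y \<in> carrier ?X" for y
  proof -
    have "(\<phi> \<circ> \<psi>) y = id y"
    proof (rule hom_eq_on_generate[where f = "\<phi> \<circ> \<psi>" and g = id, OF X.is_group X.is_group])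
      show "(\<phi> \<circ> \<psi>) s = id s" if "s \<in> chi_elt ?F ` carrier ?F \<union> chi_bar ?F ` carrier ?F" for s
        using that \<phi>i \<phi>j by (auto simp: \<psi>)
      show "y \<in> generate ?X (chi_elt ?F ` carrier ?F \<union> chi_bar ?F ` carrier ?F)"
        using that F.chi_generate by metis
      show "chi_elt ?F ` carrier ?F \<union> chi_bar ?F ` carrier ?F \<subseteq> carrier ?X"
        using F.chi_elt_hom F.chi_bar_hom by (auto simp: hom_def)
    qed (use Group.hom_compose[OF \<psi>(1) \<phi>] in \<open>auto simp: hom_def\<close>)
    then show ?thesis by simp
  qed
  have "bij_betw \<phi> (carrier ?K) (carrier ?X)"
    by (rule bij_betw_byWitness[where f' = \<psi>])
      (use \<psi>\<phi> \<phi>\<psi> hom_in_carrier[OF \<phi>] hom_in_carrier[OF \<psi>(1)] in auto)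
  then have "\<phi> \<in> iso ?K ?X"
    using \<phi> by (simp add: iso_def)
  then show ?thesis
    by (rule rev_bexI) (simp add: \<phi>_Inl \<phi>_Inr)
qed

end
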